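(* Suppose that $X$ and $Y$ are Polish spaces, $d_Y$ is a compatible metric on $Y$, and $f \colon X \to Y$ is Borel. Suppose further that for all countable sets $C \subseteq X$ and real numbers $\epsilon > 0$, there is a Baire-class one function $g \colon X \to Y$ with $\sup_{x \in C} d_Y(f(x), g(x)) \le \epsilon$. Then $f$ is Baire class one.
   Context: A subset of a topological space is $F_\sigma$ if it is a union of countably-many closed sets. A function between topological spaces is Baire class one if preimages of open sets are $F_\sigma$, and Borel if preimages of open sets are Borel. *)

theory Defs
  imports "HOL-Analysis.Analysis"
begin

text \<open>Abstract topologies are used instead of the type class \<^class>\<open>polish_space\<close>, which fixes a
  complete metric, does not cover the empty space, and forces the space to be a whole type.\<close>

definition Polish_space :: "'a topology \<Rightarrow> bool" where
  "Polish_space X \<longleftrightarrow> separable_space X \<and> completely_metrizable_space X"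

text \<open>A compatible metric need not be complete.\<close>

definition compatible_metric :: "'a topology \<Rightarrow> ('a \<Rightarrow> 'a \<Rightarrow> real) \<Rightarrow> bool" where
  "compatible_metric X d \<longleftrightarrow>
     Metric_space (topspace X) d \<and> Metric_space.mtopology (topspace X) d = X"

definition borel_in :: "'a topology \<Rightarrow> 'a set \<Rightarrow> bool" where
  "borel_in X S \<longleftrightarrow> S \<in> sigma_sets (topspace X) {U. openin X U}"

definition borel_map :: "'a topology \<Rightarrow> 'b topology \<Rightarrow> ('a \<Rightarrow> 'b) \<Rightarrow> bool" where
  "borel_map X Y f \<longleftrightarrow> f \<in> topspace X \<rightarrow> topspace Y \<and>
     (\<forall>U. openin Y U \<longrightarrow> borel_in X {x \<in> topspace X. f x \<in> U})"

definition baire_class_one :: "'a topology \<Rightarrow> 'b topology \<Rightarrow> ('a \<Rightarrow> 'b) \<Rightarrow> bool" where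
  "baire_class_one X Y f \<longleftrightarrow> f \<in> topspace X \<rightarrow> topspace Y \<and>
     (\<forall>U. openin Y U \<longrightarrow> fsigma_in X {x \<in> topspace X. f x \<in> U})"

end

theory Submission
  imports Defs
begin

text \<open>The theorem rests on a dichotomy for separating two sets \<open>A\<close> and \<open>B\<close> in a second countable
  metrizable space: either some \<open>F\<^sub>\<sigma>\<close> set contains \<open>A\<close> and misses \<open>B\<close>, or there is a nonempty closed
  set \<open>K\<close> in which both \<open>K \<inter> A\<close> and \<open>K \<inter> B\<close> are dense (\<open>fsigma_separation_dichotomy\<close>).

  Given an open \<open>U \<subseteq> Y\<close>, write \<open>U\<close> as the union of the sets \<open>U\<^sub>n\<close> of points whose ball of radius
  \<open>1 / (n + 1)\<close> lies in \<open>U\<close>. It suffices to separate \<open>A = f\<^sup>-\<^sup>1(U\<^sub>n)\<close> from \<open>B = f\<^sup>-\<^sup>1(Y - U)\<close>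
  by an \<open>F\<^sub>\<sigma>\<close> set for each \<open>n\<close>, since the union of the separating sets is then \<open>f\<^sup>-\<^sup>1(U)\<close>. If this
  fails, the dichotomy provides \<open>K\<close>, and \<open>K \<inter> A\<close>, \<open>K \<inter> B\<close> have countable subsets \<open>P\<close>, \<open>Q\<close> that
  are dense in \<open>K\<close>. All values of \<open>f\<close> on \<open>P\<close> have distance at least \<open>1 / (n + 1)\<close> from all
  values on \<open>Q\<close>, so for a Baire class one function \<open>g\<close> that is close enough to \<open>f\<close> on
  \<open>P \<union> Q\<close> the images \<open>g(P)\<close> and \<open>g(Q)\<close> have a positive distance. But then the preimages under \<open>g\<close>
  of their closures are disjoint \<open>G\<^sub>\<delta>\<close> sets, both dense in \<open>K\<close>, which contradicts the Baire
  category theorem (\<open>baire_class_one_closures_meet\<close>).\<close>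

section \<open>Countability in separable metrizable spaces\<close>

lemma separable_metrizable_imp_second_countable:
  assumes "separable_space X" "metrizable_space X"
  shows "second_countable X"
proof -
  obtain M d where "Metric_space M d" and X: "X = Metric_space.mtopology M d"
    using assms(2) metrizable_space_def by blast
  then interpret Metric_space M d by blast
  obtain D where D: "countable D" "D \<subseteq> M" "X closure_of D = M"
    using assms(1) by (auto simp: separable_space_def X)
  let ?\<B> = "(\<lambda>(c, n). mball c (inverse (Suc n))) ` (D \<times> UNIV)"
  have "\<exists>V\<in>?\<B>. x \<in> V \<and> V \<subseteq> U" if U: "openin X U" "x \<in> U" for U x
  proof -
    obtain r where r: "r > 0" "mball x r \<subseteq> U"
      using U unfolding X openin_mtopology by blast
    have xM: "x \<in> M"
      using U openin_subset unfolding X by fastforce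
    obtain n where n: "inverse (real (Suc n)) < r / 2"
      using reals_Archimedean[of "r / 2"] r(1) by auto
    have "x \<in> mtopology closure_of D"
      using D(3) xM X by simp
    moreover have "inverse (real (Suc n)) > 0"
      by simp
    ultimately obtain c where c: "c \<in> D" "c \<in> mball x (inverse (Suc n))"
      unfolding metric_closure_of by blast
    have "x \<in> mball c (inverse (Suc n))"
      using c by (auto simp: commute)
    moreover have "mball c (inverse (Suc n)) \<subseteq> mball x r"
    proof
      fix z assume z: "z \<in> mball c (inverse (Suc n))"
      then have "d x z \<le> d x c + d c z"
        using c xM by (intro triangle) auto
      also have "\<dots> < r"
        using c z n by (simp del: of_nat_Suc)
      finally show "z \<in> mball x r"
        using z xM by auto
    qed
    ultimately show ?thesis
      using c(1) r(2) by blast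
  qed
  moreover have "countable ?\<B>"
    using D(1) by blast
  moreover have "\<forall>V\<in>?\<B>. openin X V"
    by (auto simp: X)
  ultimately show ?thesis
    unfolding second_countable_def by blast
qed

lemma second_countable_imp_countable_dense_subset:
  assumes "second_countable X" "S \<subseteq> topspace X"
  obtains C where "countable C" "C \<subseteq> S" "S \<subseteq> X closure_of C"
proof -
  have "separable_space (subtopology X S)"
    using assms(1) by (intro second_countable_imp_separable_space second_countable_subtopology)
  then obtain C where C: "countable C" "C \<subseteq> S" "subtopology X S closure_of C = S"
    using assms(2) by (auto simp: separable_space_def Int_absorb1)
  have "S \<subseteq> X closure_of C"
    using C(3) closure_of_subtopology_subset by fastforce
  with C show thesis using that by blast
qed

section \<open>Separation by \<open>F\<^sub>\<sigma>\<close> sets\<close>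

text \<open>The set \<open>K\<close> is the complement of the largest open set on which \<open>A\<close> and \<open>B\<close> can be separated.
  That there is a largest one is due to the Lindelof property. If an open set \<open>V\<close> missed
  \<open>K \<inter> A\<close>, a separating set for the complement of \<open>K\<close> would also separate on \<open>V\<close>; if \<open>V\<close> missed
  \<open>K \<inter> B\<close>, it would do so after adding \<open>K \<inter> V\<close>. In both cases \<open>V\<close> is disjoint from \<open>K\<close>.\<close>

lemma fsigma_separation_dichotomy:
  assumes X: "second_countable X" "metrizable_space X"
    and A: "A \<subseteq> topspace X"
    and nosep: "\<nexists>F. fsigma_in X F \<and> A \<subseteq> F \<and> F \<inter> B = {}"
  obtains K where "closedin X K" "K \<noteq> {}" "K \<subseteq> X closure_of (K \<inter> A)" "K \<subseteq> X closure_of (K \<inter> B)"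
proof -
  define separated where
    "separated V \<longleftrightarrow> (\<exists>F. fsigma_in X F \<and> A \<inter> V \<subseteq> F \<and> F \<subseteq> V - B)" for V
  define \<V> where "\<V> = {V. openin X V \<and> separated V}"
  define W where "W = \<Union>\<V>"
  define K where "K = topspace X - W"
  have openW: "openin X W"
    unfolding W_def \<V>_def by blast
  obtain F where F: "fsigma_in X F" "A \<inter> W \<subseteq> F" "F \<subseteq> W - B"
  proof -
    have "Lindelof_space (subtopology X W)"
      using X(1) by (intro second_countable_imp_Lindelof_space second_countable_subtopology)
    moreover have "openin (subtopology X W) V" if "V \<in> \<V>" for V
      unfolding openin_open_subtopology[OF openW] using that \<V>_def W_def by blast
    moreover have "\<Union>\<V> = topspace (subtopology X W)"
      using openin_subset[OF openW] W_def by auto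
    ultimately obtain \<C> where \<C>: "countable \<C>" "\<C> \<subseteq> \<V>" "\<Union>\<C> = topspace (subtopology X W)"
      using Lindelof_spaceD by metis
    then have UC: "\<Union>\<C> = W"
      using openin_subset[OF openW] by auto
    have "\<forall>V\<in>\<C>. \<exists>F. fsigma_in X F \<and> A \<inter> V \<subseteq> F \<and> F \<subseteq> V - B"
      using \<C>(2) by (auto simp: \<V>_def separated_def)
    then obtain \<Phi> where \<Phi>: "\<And>V. V \<in> \<C> \<Longrightarrow> fsigma_in X (\<Phi> V) \<and> A \<inter> V \<subseteq> \<Phi> V \<and> \<Phi> V \<subseteq> V - B"
      by metis
    have "fsigma_in X (\<Union>(\<Phi> ` \<C>))"
      using \<C>(1) \<Phi> by (intro fsigma_in_Union) auto
    moreover have "A \<inter> W \<subseteq> \<Union>(\<Phi> ` \<C>)"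
      using \<Phi> unfolding UC[symmetric] by blast
    moreover have "\<Union>(\<Phi> ` \<C>) \<subseteq> W - B"
      using \<Phi> unfolding UC[symmetric] by blast
    ultimately show thesis using that by blast
  qed
  have closedK: "closedin X K"
    unfolding K_def using openW by blast
  have maximal: "V \<inter> K = {}" if "openin X V" "separated V" for V
    using that unfolding K_def W_def \<V>_def by blast
  have fsigma_open: "fsigma_in X V" if "openin X V" for V
    using that X(2) by (rule open_imp_fsigma_in[rotated])
  have "\<exists>y\<in>K \<inter> A. y \<in> V" if V: "openin X V" "x \<in> V" "x \<in> K" for V x
  proof (rule ccontr)
    assume "\<not> ?thesis"
    then have "A \<inter> V \<subseteq> F \<inter> V"
      using F(2) A by (auto simp: K_def)
    moreover have "fsigma_in X (F \<inter> V)"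
      using F(1) fsigma_open V(1) by (intro fsigma_in_Int)
    ultimately have "separated V"
      unfolding separated_def using F(3) by blast
    with maximal V show False by blast
  qed
  moreover have "\<exists>y\<in>K \<inter> B. y \<in> V" if V: "openin X V" "x \<in> V" "x \<in> K" for V x
  proof (rule ccontr)
    assume "\<not> ?thesis"
    then have "(F \<union> K) \<inter> V \<subseteq> V - B"
      using F(3) by blast
    moreover have "A \<inter> V \<subseteq> (F \<union> K) \<inter> V"
      using F(2) A by (auto simp: K_def)
    moreover have "fsigma_in X ((F \<union> K) \<inter> V)"
      using fsigma_in_Un[OF F(1) closed_imp_fsigma_in[OF closedK]] fsigma_open[OF V(1)]
      by (rule fsigma_in_Int)
    ultimately have "separated V"
      unfolding separated_def by blast
    with maximal V show False by blast
  qed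
  ultimately have "K \<subseteq> X closure_of (K \<inter> A)" "K \<subseteq> X closure_of (K \<inter> B)"
    using closedin_subset[OF closedK] unfolding in_closure_of subset_iff by meson+
  moreover have "K \<noteq> {}"
  proof
    assume "K = {}"
    then have "A \<subseteq> W" using A by (auto simp: K_def)
    with F nosep show False by blast
  qed
  ultimately show thesis using that closedK by blast
qed

section \<open>Baire class one functions and Baire category\<close>

lemma dense_gdelta_Int_nonempty:
  assumes X: "completely_metrizable_space X" "topspace X \<noteq> {}"
    and G: "gdelta_in X G" "X closure_of G = topspace X"
    and H: "gdelta_in X H" "X closure_of H = topspace X"
  shows "G \<inter> H \<noteq> {}"
proof -
  obtain \<G> where \<G>: "countable \<G>" "\<And>T. T \<in> \<G> \<Longrightarrow> openin X T" "\<Inter>\<G> = G"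
    using G(1) unfolding gdelta_in_alt intersection_of_def by auto
  obtain \<H> where \<H>: "countable \<H>" "\<And>T. T \<in> \<H> \<Longrightarrow> openin X T" "\<Inter>\<H> = H"
    using H(1) unfolding gdelta_in_alt intersection_of_def by auto
  have "X closure_of T = topspace X" if "T \<in> \<G> \<union> \<H>" for T
  proof -
    have "G \<subseteq> T \<or> H \<subseteq> T"
      using that \<G>(3) \<H>(3) by blast
    then have "topspace X \<subseteq> X closure_of T"
      using closure_of_mono G(2) H(2) by metis
    then show ?thesis
      by (simp add: closure_of_subset_topspace subset_antisym)
  qed
  then have "X closure_of \<Inter>(\<G> \<union> \<H>) = topspace X"
    using X(1) \<G> \<H> by (intro Baire_category) auto
  moreover have "\<Inter>(\<G> \<union> \<H>) = G \<inter> H"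
    using \<G>(3) \<H>(3) by blast
  ultimately have "X closure_of (G \<inter> H) = topspace X"
    by simp
  moreover have "X closure_of {} = {}"
    by (rule closure_of_empty)
  ultimately show ?thesis
    using X(2) by force
qed

lemma baire_class_one_gdelta_preimage:
  assumes "baire_class_one X Y g" "closedin Y Z"
  shows "gdelta_in X {x \<in> topspace X. g x \<in> Z}"
proof -
  have "fsigma_in X {x \<in> topspace X. g x \<in> topspace Y - Z}"
    using assms unfolding baire_class_one_def by blast
  moreover have "{x \<in> topspace X. g x \<in> topspace Y - Z}
      = topspace X - {x \<in> topspace X. g x \<in> Z}"
    using assms(1) unfolding baire_class_one_def by auto
  ultimately show ?thesis
    by (auto simp: gdelta_in_fsigma_in)
qed

text \<open>This is the part needed here of the fact that a Baire class one function has a point of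
  continuity on each nonempty closed set. The preimages of the two closures trace dense
  \<open>G\<^sub>\<delta>\<close> sets on \<open>K\<close>, and these have a common point.\<close>

lemma baire_class_one_closures_meet:
  assumes X: "completely_metrizable_space X" and g: "baire_class_one X Y g"
    and K: "closedin X K" "K \<noteq> {}"
    and P: "P \<subseteq> K" "K \<subseteq> X closure_of P"
    and Q: "Q \<subseteq> K" "K \<subseteq> X closure_of Q"
  shows "Y closure_of (g ` P) \<inter> Y closure_of (g ` Q) \<noteq> {}"
proof -
  let ?XK = "subtopology X K"
  have KX: "K \<subseteq> topspace X"
    using K(1) by (rule closedin_subset)
  have top: "topspace ?XK = K"
    using KX by auto
  have trace: "gdelta_in ?XK ({x \<in> topspace X. g x \<in> Y closure_of (g ` S)} \<inter> K)"
    and dense: "?XK closure_of ({x \<in> topspace X. g x \<in> Y closure_of (g ` S)} \<inter> K) = topspace ?XK"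
    if S: "S \<subseteq> K" "K \<subseteq> X closure_of S" for S
  proof -
    let ?G = "{x \<in> topspace X. g x \<in> Y closure_of (g ` S)} \<inter> K"
    show "gdelta_in ?XK ?G"
      unfolding gdelta_in_subtopology
      using baire_class_one_gdelta_preimage[OF g closedin_closure_of] by blast
    have "g ` S \<subseteq> topspace Y"
      using g S(1) KX unfolding baire_class_one_def by auto
    then have "S \<subseteq> ?G"
      using S(1) KX closure_of_subset by fastforce
    then have "?XK closure_of S \<subseteq> ?XK closure_of ?G"
      by (rule closure_of_mono)
    moreover have "?XK closure_of S = K"
      using S by (auto simp: closure_of_subtopology Int_absorb1)
    ultimately show "?XK closure_of ?G = topspace ?XK"
      using top closure_of_subset_topspace by (metis subset_antisym)
  qed
  have "completely_metrizable_space ?XK"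
    using X K(1) by (rule completely_metrizable_space_closedin)
  then have "({x \<in> topspace X. g x \<in> Y closure_of (g ` P)} \<inter> K)
      \<inter> ({x \<in> topspace X. g x \<in> Y closure_of (g ` Q)} \<inter> K) \<noteq> {}"
    using trace[OF P] dense[OF P] trace[OF Q] dense[OF Q] K(2) top
    by (intro dense_gdelta_Int_nonempty[of ?XK]) auto
  then show ?thesis by blast
qed

section \<open>Approximation on countable sets\<close>

theorem theorem1p2:
  fixes X :: "'a topology" and Y :: "'b topology"
    and d :: "'b \<Rightarrow> 'b \<Rightarrow> real" and f :: "'a \<Rightarrow> 'b"
  assumes "Polish_space X" and "Polish_space Y"
    and "compatible_metric Y d"
    and "borel_map X Y f"
    and "\<And>(C :: 'a set) (\<epsilon> :: real). C \<subseteq> topspace X \<Longrightarrow> countable C \<Longrightarrow> \<epsilon> > 0 \<Longrightarrow>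
           \<exists>g. baire_class_one X Y g \<and> (SUP x\<in>C. ennreal (d (f x) (g x))) \<le> ennreal \<epsilon>"
  shows "baire_class_one X Y f"
proof -
  have cm: "completely_metrizable_space X" and mX: "metrizable_space X" and sc: "second_countable X"
    using assms(1) completely_metrizable_imp_metrizable_space
      separable_metrizable_imp_second_countable
    by (auto simp: Polish_space_def)
  define M where "M = topspace Y"
  interpret Metric_space M d
    using assms(3) by (simp add: compatible_metric_def M_def)
  have Y: "mtopology = Y"
    using assms(3) by (simp add: compatible_metric_def M_def)
  have f: "f x \<in> M" if "x \<in> topspace X" for x
    using assms(4) that by (auto simp: borel_map_def M_def)
  have sep: "\<exists>F. fsigma_in X F \<and> {x \<in> topspace X. mball (f x) r \<subseteq> U} \<subseteq> F
      \<and> F \<inter> {x \<in> topspace X. f x \<notin> U} = {}" if r: "r > 0" for U r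
  proof (rule ccontr)
    let ?A = "{x \<in> topspace X. mball (f x) r \<subseteq> U}"
    let ?B = "{x \<in> topspace X. f x \<notin> U}"
    assume "\<not> ?thesis"
    then obtain K where K: "closedin X K" "K \<noteq> {}"
        "K \<subseteq> X closure_of (K \<inter> ?A)" "K \<subseteq> X closure_of (K \<inter> ?B)"
      using fsigma_separation_dichotomy[OF sc mX, of ?A ?B] by blast
    have KX: "K \<subseteq> topspace X"
      using K(1) by (rule closedin_subset)
    obtain P where P: "countable P" "P \<subseteq> K \<inter> ?A" "K \<inter> ?A \<subseteq> X closure_of P"
      using second_countable_imp_countable_dense_subset[OF sc, of "K \<inter> ?A"] by blast
    obtain Q where Q: "countable Q" "Q \<subseteq> K \<inter> ?B" "K \<inter> ?B \<subseteq> X closure_of Q"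
      using second_countable_imp_countable_dense_subset[OF sc, of "K \<inter> ?B"] by blast
    have KP: "K \<subseteq> X closure_of P"
      using K(3) closure_of_minimal[OF P(3) closedin_closure_of] by blast
    have KQ: "K \<subseteq> X closure_of Q"
      using K(4) closure_of_minimal[OF Q(3) closedin_closure_of] by blast
    obtain g where g: "baire_class_one X Y g"
        and sup: "(SUP x\<in>P \<union> Q. ennreal (d (f x) (g x))) \<le> ennreal (r / 4)"
    proof -
      have "P \<union> Q \<subseteq> topspace X" using P(2) Q(2) by blast
      moreover have "countable (P \<union> Q)" using P(1) Q(1) by simp
      moreover have "r / 4 > 0" using r by simp
      ultimately show thesis using assms(5) that by blast
    qed
    have gM: "g x \<in> M" if "x \<in> topspace X" for x
      using g that by (auto simp: baire_class_one_def M_def)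
    have close: "d (f x) (g x) \<le> r / 4" if "x \<in> P \<union> Q" for x
    proof -
      have "ennreal (d (f x) (g x)) \<le> ennreal (r / 4)"
        using SUP_le_iff[THEN iffD1, OF sup] that by blast
      then show ?thesis using r by simp
    qed
    obtain y where y: "y \<in> mtopology closure_of (g ` P)" "y \<in> mtopology closure_of (g ` Q)"
      using baire_class_one_closures_meet[OF cm g K(1,2) _ KP _ KQ] P(2) Q(2) unfolding Y by blast
    have r4: "r / 4 > 0" using r by simp
    obtain p where p: "p \<in> P" "g p \<in> mball y (r / 4)"
      using y(1) r4 unfolding metric_closure_of by blast
    obtain q where q: "q \<in> Q" "g q \<in> mball y (r / 4)"
      using y(2) r4 unfolding metric_closure_of by blast
    have pq: "p \<in> ?A" "q \<in> ?B" using p q P Q by blast+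
    then have M: "f p \<in> M" "f q \<in> M" "g p \<in> M" "g q \<in> M" "y \<in> M"
      using f gM p by auto
    \<comment> \<open>The path from \<open>f p\<close> to \<open>f q\<close> through \<open>g p\<close>, \<open>y\<close>, \<open>g q\<close> has four steps of length at most
      \<open>r / 4\<close>, and the two at \<open>y\<close> are strictly shorter.\<close>
    have "d (f p) (f q) \<le> d (f p) (g p) + d (g p) y + d y (g q) + d (g q) (f q)"
      using triangle[of "f p" "g p" "f q"] triangle[of "g p" y "f q"] triangle[of y "g q" "f q"] M
      by linarith
    also have "\<dots> < r"
      using close[of p] close[of q] p q commute[of y "g p"] commute[of "f q" "g q"] by auto
    finally have "f q \<in> mball (f p) r" using M by simp
    with pq show False by blast
  qed
  have "fsigma_in X {x \<in> topspace X. f x \<in> U}" if U: "openin Y U" for U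
  proof -
    have "\<exists>F. \<forall>n. fsigma_in X (F n) \<and> {x \<in> topspace X. mball (f x) (inverse (Suc n)) \<subseteq> U} \<subseteq> F n
      \<and> F n \<inter> {x \<in> topspace X. f x \<notin> U} = {}"
      by (intro choice allI sep) simp
    then obtain F where F: "\<And>n. fsigma_in X (F n)"
        "\<And>n. {x \<in> topspace X. mball (f x) (inverse (Suc n)) \<subseteq> U} \<subseteq> F n"
        "\<And>n. F n \<inter> {x \<in> topspace X. f x \<notin> U} = {}"
      by blast
    have "{x \<in> topspace X. f x \<in> U} = \<Union>(range F)"
    proof
      show "\<Union>(range F) \<subseteq> {x \<in> topspace X. f x \<in> U}"
        using F(3) fsigma_in_subset[OF F(1)] by blast
      show "{x \<in> topspace X. f x \<in> U} \<subseteq> \<Union>(range F)"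
      proof clarify
        fix x assume x: "x \<in> topspace X" "f x \<in> U"
        then obtain r where r: "r > 0" "mball (f x) r \<subseteq> U"
          using U unfolding Y[symmetric] openin_mtopology by blast
        obtain n where "inverse (real (Suc n)) < r"
          using reals_Archimedean r(1) by blast
        then have "mball (f x) (inverse (Suc n)) \<subseteq> U"
          using r(2) mball_subset_concentric[of "inverse (Suc n)" r "f x"] by force
        with F(2)[of n] x(1) show "x \<in> \<Union>(range F)" by blast
      qed
    qed
    then show ?thesis
      using F(1) by (auto intro!: fsigma_in_Union)
  qed
  then show ?thesis
    using f by (auto simp: baire_class_one_def M_def)
qed

end
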